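(* For every $f:\mathcal X\times\mathcal Y\to\mathcal Z$ with $k=\lceil\log|\mathcal Z|\rceil$ and every $0<\epsilon<\frac12$, $$R^{\mathrm{oot}}_\epsilon(f)\le R^{\mathrm{uni}}_\epsilon(f)\le R^{\mathrm{loc}}_\epsilon(f)\le R^{\mathrm{op}}_\epsilon(f)\le R^{\mathrm{oot}}_\epsilon(f)+k+1,$$ and $$D^{\mathrm{oot}}(\mathrm{CondId}_n)\in O(1),\qquad R^{\mathrm{uni}}_\epsilon(\mathrm{CondId}_n)\in\Omega(n).$$
   Context: $\mathrm{CondId}_n:\{0,1\}^n\times\{0,1\}^n\to\{0,1\}^n$ is $\mathrm{CondId}_n(x,y)=x$ if $x_0=y_0$ and $y$ otherwise, where $x_0,y_0$ are the first bits. Two-party communication with private randomness $r_A,r_B$, public randomness $r$, transcript $t_\pi$ (exchanged bits, public randomness excluded), cost = maximum number of bits exchanged. Output models with error $\epsilon$ (correct with probability at least $1-\epsilon$ on every input): open — a map $O(t_\pi,r)$ equals $f(x,y)$; local — $O_A(t_\pi,r,r_A,x)$ and $O_B(t_\pi,r,r_B,y)$ both equal $f(x,y)$; Alice (resp. Bob) — $O_A(t_\pi,r,r_A,x)=f(x,y)$ (resp. $O_B(t_\pi,r,r_B,y)=f(x,y)$); one-out-of-two — $O_A,O_B$ take values in $\mathcal Z\cup\{\top\}$ and $(O_A,O_B)\in\{(f(x,y),\top),(\top,f(x,y))\}$. $R^{\mathcal M}_\epsilon$ is the minimum cost in model $\mathcal M$ (public and private coins allowed), $R^{\mathrm{uni}}_\epsilon=\min(R^A_\epsilon,R^B_\epsilon)$,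 $D^{\mathcal M}=R^{\mathcal M}_0$. The $\Omega(n)$ is as $n\to\infty$ for fixed $\epsilon$. Logarithms base 2. *)

theory Defs
  imports
    "HOL-Probability.Probability_Mass_Function"
    "HOL-Library.Extended_Nat"
    "HOL-Library.Landau_Symbols"
begin

(* 'u and 'v are what Alice and Bob know privately: their input and their private coins.
   A node carries the bit sent there as a function of the sender's knowledge; the two
   children are the continuations after bit False and bit True. *)
datatype ('u, 'v) ptree =
    Halt
  | Alice_sends "'u \<Rightarrow> bool" "('u, 'v) ptree" "('u, 'v) ptree"
  | Bob_sends "'v \<Rightarrow> bool" "('u, 'v) ptree" "('u, 'v) ptree"

fun path :: "('u, 'v) ptree \<Rightarrow> 'u \<Rightarrow> 'v \<Rightarrow> bool list" where
  "path Halt u v = []"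
| "path (Alice_sends m t0 t1) u v = m u # path (if m u then t1 else t0) u v"
| "path (Bob_sends m t0 t1) u v = m v # path (if m v then t1 else t0) u v"

(* The random strings are encoded as natural numbers with arbitrary discrete distributions.
   The public string selects the whole tree, so it may influence every message and also
   who speaks next. *)
record ('x, 'y) protocol =
  Alice_coins :: "nat pmf"
  Bob_coins :: "nat pmf"
  public_coins :: "nat pmf"
  tree :: "nat \<Rightarrow> ('x \<times> nat, 'y \<times> nat) ptree"

definition coins :: "('x, 'y) protocol \<Rightarrow> (nat \<times> nat \<times> nat) pmf" where
  "coins \<pi> = pair_pmf (Alice_coins \<pi>) (pair_pmf (Bob_coins \<pi>) (public_coins \<pi>))"

definition transcript ::
    "('x, 'y) protocol \<Rightarrow> 'x \<Rightarrow> 'y \<Rightarrow> nat \<Rightarrow> nat \<Rightarrow> nat \<Rightarrow> bool list" where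
  "transcript \<pi> x y rA rB r = path (tree \<pi> r) (x, rA) (y, rB)"

definition cost :: "'x set \<Rightarrow> 'y set \<Rightarrow> ('x, 'y) protocol \<Rightarrow> enat" where
  "cost X Y \<pi> =
     (SUP (x, y, rA, rB, r) \<in> X \<times> Y \<times> set_pmf (coins \<pi>).
        enat (length (transcript \<pi> x y rA rB r)))"

definition succeeds ::
    "real \<Rightarrow> 'x set \<Rightarrow> 'y set \<Rightarrow> ('x, 'y) protocol \<Rightarrow>
     ('x \<Rightarrow> 'y \<Rightarrow> nat \<Rightarrow> nat \<Rightarrow> nat \<Rightarrow> bool) \<Rightarrow> bool" where
  "succeeds \<epsilon> X Y \<pi> correct \<longleftrightarrow>
     (\<forall>x\<in>X. \<forall>y\<in>Y.
        measure_pmf.prob (coins \<pi>) {(rA, rB, r). correct x y rA rB r} \<ge> 1 - \<epsilon>)"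

(* In all models the output maps range over the whole type rather than over the codomain of f;
   outputs outside the codomain are never correct. *)

definition computes_open ::
    "real \<Rightarrow> 'x set \<Rightarrow> 'y set \<Rightarrow> ('x \<Rightarrow> 'y \<Rightarrow> 'z) \<Rightarrow> ('x, 'y) protocol \<Rightarrow> bool" where
  "computes_open \<epsilon> X Y f \<pi> \<longleftrightarrow>
     (\<exists>out :: bool list \<Rightarrow> nat \<Rightarrow> 'z.
        succeeds \<epsilon> X Y \<pi> (\<lambda>x y rA rB r. out (transcript \<pi> x y rA rB r) r = f x y))"

definition computes_local ::
    "real \<Rightarrow> 'x set \<Rightarrow> 'y set \<Rightarrow> ('x \<Rightarrow> 'y \<Rightarrow> 'z) \<Rightarrow> ('x, 'y) protocol \<Rightarrow> bool" where
  "computes_local \<epsilon> X Y f \<pi> \<longleftrightarrow>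
     (\<exists>(outA :: bool list \<Rightarrow> nat \<Rightarrow> nat \<Rightarrow> 'x \<Rightarrow> 'z)
       (outB :: bool list \<Rightarrow> nat \<Rightarrow> nat \<Rightarrow> 'y \<Rightarrow> 'z).
        succeeds \<epsilon> X Y \<pi> (\<lambda>x y rA rB r.
          outA (transcript \<pi> x y rA rB r) r rA x = f x y \<and>
          outB (transcript \<pi> x y rA rB r) r rB y = f x y))"

definition computes_Alice ::
    "real \<Rightarrow> 'x set \<Rightarrow> 'y set \<Rightarrow> ('x \<Rightarrow> 'y \<Rightarrow> 'z) \<Rightarrow> ('x, 'y) protocol \<Rightarrow> bool" where
  "computes_Alice \<epsilon> X Y f \<pi> \<longleftrightarrow>
     (\<exists>outA :: bool list \<Rightarrow> nat \<Rightarrow> nat \<Rightarrow> 'x \<Rightarrow> 'z.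
        succeeds \<epsilon> X Y \<pi> (\<lambda>x y rA rB r. outA (transcript \<pi> x y rA rB r) r rA x = f x y))"

definition computes_Bob ::
    "real \<Rightarrow> 'x set \<Rightarrow> 'y set \<Rightarrow> ('x \<Rightarrow> 'y \<Rightarrow> 'z) \<Rightarrow> ('x, 'y) protocol \<Rightarrow> bool" where
  "computes_Bob \<epsilon> X Y f \<pi> \<longleftrightarrow>
     (\<exists>outB :: bool list \<Rightarrow> nat \<Rightarrow> nat \<Rightarrow> 'y \<Rightarrow> 'z.
        succeeds \<epsilon> X Y \<pi> (\<lambda>x y rA rB r. outB (transcript \<pi> x y rA rB r) r rB y = f x y))"

(* one-out-of-two; None is the symbol "top" of a player who leaves the output to the other *)
definition computes_oot ::
    "real \<Rightarrow> 'x set \<Rightarrow> 'y set \<Rightarrow> ('x \<Rightarrow> 'y \<Rightarrow> 'z) \<Rightarrow> ('x, 'y) protocol \<Rightarrow> bool" where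
  "computes_oot \<epsilon> X Y f \<pi> \<longleftrightarrow>
     (\<exists>(outA :: bool list \<Rightarrow> nat \<Rightarrow> nat \<Rightarrow> 'x \<Rightarrow> 'z option)
       (outB :: bool list \<Rightarrow> nat \<Rightarrow> nat \<Rightarrow> 'y \<Rightarrow> 'z option).
        succeeds \<epsilon> X Y \<pi> (\<lambda>x y rA rB r.
          (outA (transcript \<pi> x y rA rB r) r rA x, outB (transcript \<pi> x y rA rB r) r rB y)
            \<in> {(Some (f x y), None), (None, Some (f x y))}))"

(* The infima below are minima, because enat is well-ordered; the value is infinite
   iff no protocol of bounded cost exists (possible only if X or Y is infinite). *)

definition R_open :: "real \<Rightarrow> 'x set \<Rightarrow> 'y set \<Rightarrow> ('x \<Rightarrow> 'y \<Rightarrow> 'z) \<Rightarrow> enat" where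
  "R_open \<epsilon> X Y f = (INF \<pi> \<in> {\<pi>. computes_open \<epsilon> X Y f \<pi>}. cost X Y \<pi>)"

definition R_local :: "real \<Rightarrow> 'x set \<Rightarrow> 'y set \<Rightarrow> ('x \<Rightarrow> 'y \<Rightarrow> 'z) \<Rightarrow> enat" where
  "R_local \<epsilon> X Y f = (INF \<pi> \<in> {\<pi>. computes_local \<epsilon> X Y f \<pi>}. cost X Y \<pi>)"

definition R_Alice :: "real \<Rightarrow> 'x set \<Rightarrow> 'y set \<Rightarrow> ('x \<Rightarrow> 'y \<Rightarrow> 'z) \<Rightarrow> enat" where
  "R_Alice \<epsilon> X Y f = (INF \<pi> \<in> {\<pi>. computes_Alice \<epsilon> X Y f \<pi>}. cost X Y \<pi>)"

definition R_Bob :: "real \<Rightarrow> 'x set \<Rightarrow> 'y set \<Rightarrow> ('x \<Rightarrow> 'y \<Rightarrow> 'z) \<Rightarrow> enat" where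
  "R_Bob \<epsilon> X Y f = (INF \<pi> \<in> {\<pi>. computes_Bob \<epsilon> X Y f \<pi>}. cost X Y \<pi>)"

definition R_uni :: "real \<Rightarrow> 'x set \<Rightarrow> 'y set \<Rightarrow> ('x \<Rightarrow> 'y \<Rightarrow> 'z) \<Rightarrow> enat" where
  "R_uni \<epsilon> X Y f = min (R_Alice \<epsilon> X Y f) (R_Bob \<epsilon> X Y f)"

definition R_oot :: "real \<Rightarrow> 'x set \<Rightarrow> 'y set \<Rightarrow> ('x \<Rightarrow> 'y \<Rightarrow> 'z) \<Rightarrow> enat" where
  "R_oot \<epsilon> X Y f = (INF \<pi> \<in> {\<pi>. computes_oot \<epsilon> X Y f \<pi>}. cost X Y \<pi>)"

definition D_oot :: "'x set \<Rightarrow> 'y set \<Rightarrow> ('x \<Rightarrow> 'y \<Rightarrow> 'z) \<Rightarrow> enat" where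
  "D_oot X Y f = R_oot 0 X Y f"

definition bits :: "nat \<Rightarrow> bool list set" where
  "bits n = {x. length x = n}"

(* CondId_n is the restriction of this function to bits n. *)
definition CondId :: "bool list \<Rightarrow> bool list \<Rightarrow> bool list" where
  "CondId x y = (if x ! 0 = y ! 0 then x else y)"

end

theory Submission
  imports Defs
begin

(* Upper bounds: a one-out-of-two protocol becomes open when Alice announces which player
   holds the value and that player sends it. For CondId, exchanging the first bits suffices.
   Lower bound: for x and y with different first bits Alice must name y, so with all coins
   fixed she is right on at most as many y as there are transcripts; averaging over y gives
   2^(n-1) * (1 - eps) \<le> 2^(c+1). For Bob take equal first bits, when he must name x. *)

section \<open>Costs and success probabilities\<close>

text \<open>A finite bound on a complexity yields an actual protocol: \<open>\<le> enat c\<close>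
  amounts to \<open>< enat (Suc c)\<close>, and a strict upper bound on an infimum always has a
  witness.\<close>

lemma INF_enat_le_iff: "(INF p\<in>P. g p) \<le> enat c \<longleftrightarrow> (\<exists>p\<in>P. g p \<le> enat c)"
proof -
  have "(INF p\<in>P. g p) < enat (Suc c) \<longleftrightarrow> (\<exists>p\<in>P. g p < enat (Suc c))"
    by (rule INF_less_iff)
  moreover have "m < enat (Suc c) \<longleftrightarrow> m \<le> enat c" for m
    by (cases m) auto
  ultimately show ?thesis
    by simp
qed

lemma cost_le_iff:
  "cost X Y \<pi> \<le> enat c \<longleftrightarrow>
     (\<forall>x\<in>X. \<forall>y\<in>Y. \<forall>rA rB r. (rA, rB, r) \<in> set_pmf (coins \<pi>) \<longrightarrow>
        length (transcript \<pi> x y rA rB r) \<le> c)"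
  unfolding cost_def SUP_le_iff by (fastforce simp: Ball_def)

text \<open>Only the coins of the two protocols have to agree. The trees may differ, so success
  carries over from a protocol to an extension of it by inclusion of events.\<close>

lemma succeeds_mono:
  assumes "succeeds \<epsilon> X Y \<pi> C" and "coins \<pi>' = coins \<pi>"
    and "\<And>x y rA rB r. x \<in> X \<Longrightarrow> y \<in> Y \<Longrightarrow> C x y rA rB r \<Longrightarrow> C' x y rA rB r"
  shows "succeeds \<epsilon> X Y \<pi>' C'"
  unfolding succeeds_def
proof (intro ballI)
  fix x y assume xy: "x \<in> X" "y \<in> Y"
  have "1 - \<epsilon> \<le> measure_pmf.prob (coins \<pi>) {(rA, rB, r). C x y rA rB r}"
    using assms(1) xy by (simp add: succeeds_def)
  also have "\<dots> \<le> measure_pmf.prob (coins \<pi>) {(rA, rB, r). C' x y rA rB r}"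
    using assms(3) xy by (intro measure_pmf.finite_measure_mono) auto
  finally show "measure_pmf.prob (coins \<pi>') {(rA, rB, r). C' x y rA rB r} \<ge> 1 - \<epsilon>"
    by (simp add: assms(2))
qed

lemma succeeds_error_mono:
  "succeeds \<epsilon> X Y \<pi> C \<Longrightarrow> \<epsilon> \<le> \<epsilon>' \<Longrightarrow> succeeds \<epsilon>' X Y \<pi> C"
  unfolding succeeds_def by force

lemma succeeds_always:
  assumes "0 \<le> \<epsilon>"
    and "\<And>x y rA rB r. x \<in> X \<Longrightarrow> y \<in> Y \<Longrightarrow> C x y rA rB r"
  shows "succeeds \<epsilon> X Y \<pi> C"
  unfolding succeeds_def
proof (intro ballI)
  fix x y assume "x \<in> X" "y \<in> Y"
  then have "{(rA, rB, r). C x y rA rB r} = UNIV"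
    using assms(2) by auto
  then show "measure_pmf.prob (coins \<pi>) {(rA, rB, r). C x y rA rB r} \<ge> 1 - \<epsilon>"
    using assms(1) by simp
qed

section \<open>Comparison of the output models\<close>

lemma computes_oot_if_Alice: "computes_Alice \<epsilon> X Y f \<pi> \<Longrightarrow> computes_oot \<epsilon> X Y f \<pi>"
proof -
  assume "computes_Alice \<epsilon> X Y f \<pi>"
  then obtain outA where
    "succeeds \<epsilon> X Y \<pi> (\<lambda>x y rA rB r. outA (transcript \<pi> x y rA rB r) r rA x = f x y)"
    unfolding computes_Alice_def by blast
  then show ?thesis
    unfolding computes_oot_def
    by (intro exI[of _ "\<lambda>t r rA x. Some (outA t r rA x)"] exI[of _ "\<lambda>t r rB y. None"])
       (erule succeeds_mono; simp)
qed

lemma computes_oot_if_Bob: "computes_Bob \<epsilon> X Y f \<pi> \<Longrightarrow> computes_oot \<epsilon> X Y f \<pi>"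
proof -
  assume "computes_Bob \<epsilon> X Y f \<pi>"
  then obtain outB where
    "succeeds \<epsilon> X Y \<pi> (\<lambda>x y rA rB r. outB (transcript \<pi> x y rA rB r) r rB y = f x y)"
    unfolding computes_Bob_def by blast
  then show ?thesis
    unfolding computes_oot_def
    by (intro exI[of _ "\<lambda>t r rA x. None"] exI[of _ "\<lambda>t r rB y. Some (outB t r rB y)"])
       (erule succeeds_mono; simp)
qed

lemma computes_Alice_if_local: "computes_local \<epsilon> X Y f \<pi> \<Longrightarrow> computes_Alice \<epsilon> X Y f \<pi>"
  unfolding computes_local_def computes_Alice_def
  by (elim exE, rule exI, erule succeeds_mono) auto

lemma computes_local_if_open: "computes_open \<epsilon> X Y f \<pi> \<Longrightarrow> computes_local \<epsilon> X Y f \<pi>"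
proof -
  assume "computes_open \<epsilon> X Y f \<pi>"
  then obtain out where
    "succeeds \<epsilon> X Y \<pi> (\<lambda>x y rA rB r. out (transcript \<pi> x y rA rB r) r = f x y)"
    unfolding computes_open_def by blast
  then show ?thesis
    unfolding computes_local_def
    by (intro exI[of _ "\<lambda>t r rA x. out t r"] exI[of _ "\<lambda>t r rB y. out t r"])
       (erule succeeds_mono; simp)
qed

lemma R_oot_le_R_uni: "R_oot \<epsilon> X Y f \<le> R_uni \<epsilon> X Y f"
  unfolding R_oot_def R_uni_def R_Alice_def R_Bob_def
  by (intro min.boundedI INF_superset_mono)
     (auto intro: computes_oot_if_Alice computes_oot_if_Bob)

lemma R_uni_le_R_local: "R_uni \<epsilon> X Y f \<le> R_local \<epsilon> X Y f"
  unfolding R_uni_def R_local_def R_Alice_def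
  by (intro min.coboundedI1 INF_superset_mono) (auto intro: computes_Alice_if_local)

lemma R_local_le_R_open: "R_local \<epsilon> X Y f \<le> R_open \<epsilon> X Y f"
  unfolding R_local_def R_open_def
  by (intro INF_superset_mono) (auto intro: computes_local_if_open)

text \<open>Carries the zero-error bound for \<open>CondId\<close> over to error \<epsilon>.\<close>

lemma R_oot_antimono: "\<epsilon> \<le> \<epsilon>' \<Longrightarrow> R_oot \<epsilon>' X Y f \<le> R_oot \<epsilon> X Y f"
  unfolding R_oot_def computes_oot_def
  by (intro INF_superset_mono) (auto intro: succeeds_error_mono)

section \<open>From one-out-of-two to open protocols\<close>

text \<open>Sequential composition. The recursive calls put the bit just sent back in front, so at a
  leaf \<open>g\<close> receives the whole transcript and the continuation may depend on it.\<close>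

fun extend :: "('u, 'v) ptree \<Rightarrow> (bool list \<Rightarrow> ('u, 'v) ptree) \<Rightarrow> ('u, 'v) ptree" where
  "extend Halt g = g []"
| "extend (Alice_sends m t0 t1) g =
     Alice_sends m (extend t0 (\<lambda>p. g (False # p))) (extend t1 (\<lambda>p. g (True # p)))"
| "extend (Bob_sends m t0 t1) g =
     Bob_sends m (extend t0 (\<lambda>p. g (False # p))) (extend t1 (\<lambda>p. g (True # p)))"

lemma path_extend: "path (extend t g) u v = path t u v @ path (g (path t u v)) u v"
  by (induction t arbitrary: g) auto

text \<open>The length is fixed in advance, so the shape of the tree does not depend on the message;
  both children are equal because no later bit depends on how an earlier one was received.\<close>

fun Alice_sends_list :: "nat \<Rightarrow> ('u \<Rightarrow> bool list) \<Rightarrow> ('u, 'v) ptree" where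
  "Alice_sends_list 0 e = Halt"
| "Alice_sends_list (Suc n) e =
     Alice_sends (\<lambda>u. hd (e u)) (Alice_sends_list n (\<lambda>u. tl (e u)))
       (Alice_sends_list n (\<lambda>u. tl (e u)))"

fun Bob_sends_list :: "nat \<Rightarrow> ('v \<Rightarrow> bool list) \<Rightarrow> ('u, 'v) ptree" where
  "Bob_sends_list 0 e = Halt"
| "Bob_sends_list (Suc n) e =
     Bob_sends (\<lambda>v. hd (e v)) (Bob_sends_list n (\<lambda>v. tl (e v)))
       (Bob_sends_list n (\<lambda>v. tl (e v)))"

lemma path_Alice_sends_list: "length (e u) = n \<Longrightarrow> path (Alice_sends_list n e) u v = e u"
  by (induction n arbitrary: e) (auto simp: length_Suc_conv)

lemma path_Bob_sends_list: "length (e v) = n \<Longrightarrow> path (Bob_sends_list n e) u v = e v"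
  by (induction n arbitrary: e) (auto simp: length_Suc_conv)

lemma finite_bits: "finite (bits n)" and card_bits: "card (bits n) = 2 ^ n"
  using finite_lists_length_eq[of "UNIV :: bool set" n] card_lists_length_eq[of "UNIV :: bool set" n]
  by (simp_all add: bits_def)

text \<open>Length \<open>k\<close> is demanded for every \<open>z\<close>, also outside
  \<open>Z\<close>: an erring player may hold any value of the type, and the cost bound covers
  erring runs too.\<close>

lemma ex_encoding:
  assumes "finite Z" and "card Z \<le> 2 ^ k"
  shows "\<exists>e :: 'z \<Rightarrow> bool list. inj_on e Z \<and> (\<forall>z. length (e z) = k)"
proof -
  obtain e where e: "inj_on e Z" "e ` Z \<subseteq> bits k"
    using assms card_le_inj[of Z "bits k"] finite_bits[of k] by (auto simp: card_bits)
  define e' where "e' = (\<lambda>z. if z \<in> Z then e z else replicate k False)"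
  have "inj_on e' Z"
    using e(1) by (auto simp: e'_def inj_on_def)
  moreover have "\<forall>z. length (e' z) = k"
    using e(2) by (auto simp: e'_def bits_def)
  ultimately show ?thesis by blast
qed

text \<open>One bit of announcement and \<open>k\<close> bits of encoded value are appended. The
  coins stay the same and every outcome that was correct remains correct, so the error does not
  grow.\<close>

lemma R_open_le_if_R_oot_le:
  fixes f :: "'x \<Rightarrow> 'y \<Rightarrow> 'z"
  assumes "finite Z" and "card Z \<le> 2 ^ k"
    and fZ: "\<And>x y. x \<in> X \<Longrightarrow> y \<in> Y \<Longrightarrow> f x y \<in> Z"
    and "R_oot \<epsilon> X Y f \<le> enat c"
  shows "R_open \<epsilon> X Y f \<le> enat (c + k + 1)"
proof -
  obtain \<pi> where "computes_oot \<epsilon> X Y f \<pi>" and c: "cost X Y \<pi> \<le> enat c"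
    using assms(4) unfolding R_oot_def INF_enat_le_iff by auto
  then obtain outA outB where out: "succeeds \<epsilon> X Y \<pi> (\<lambda>x y rA rB r.
        (outA (transcript \<pi> x y rA rB r) r rA x, outB (transcript \<pi> x y rA rB r) r rB y)
          \<in> {(Some (f x y), None), (None, Some (f x y))})"
    unfolding computes_oot_def by blast
  obtain e :: "'z \<Rightarrow> bool list" where e: "inj_on e Z" "\<And>z. length (e z) = k"
    using ex_encoding[OF assms(1,2)] by blast
  define sendA :: "nat \<Rightarrow> bool list \<Rightarrow> ('x \<times> nat, 'y \<times> nat) ptree" where
    "sendA = (\<lambda>r p. Alice_sends_list k (\<lambda>(x, rA). e (the (outA p r rA x))))"
  \<comment> \<open>In an erring run both outputs may be \<open>None\<close>;
    \<open>the None\<close> is then an unspecified value whose code still has length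
    \<open>k\<close>.\<close>
  define sendB :: "nat \<Rightarrow> bool list \<Rightarrow> ('x \<times> nat, 'y \<times> nat) ptree" where
    "sendB = (\<lambda>r p. Bob_sends_list k (\<lambda>(y, rB). e (the (outB p r rB y))))"
  (* The last k bits alone determine the value; the announcement is needed only because the
     transcript has to fix who speaks next. *)
  define announce where
    "announce = (\<lambda>r p. Alice_sends (\<lambda>(x, rA). outA p r rA x \<noteq> None) (sendB r p) (sendA r p))"
  define \<pi>' where "\<pi>' = \<pi>\<lparr>tree := \<lambda>r. extend (tree \<pi> r) (announce r)\<rparr>"
  have coins: "coins \<pi>' = coins \<pi>"
    by (simp add: \<pi>'_def coins_def)
  have tr: "transcript \<pi>' x y rA rB r =
      (let p = transcript \<pi> x y rA rB r; a = outA p r rA x in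
        p @ (a \<noteq> None) # e (the (if a \<noteq> None then a else outB p r rB y)))" for x y rA rB r
    by (auto simp: transcript_def \<pi>'_def path_extend announce_def sendA_def sendB_def Let_def
        path_Alice_sends_list path_Bob_sends_list e(2))
  have "computes_open \<epsilon> X Y f \<pi>'"
    unfolding computes_open_def
  proof (intro exI, rule succeeds_mono[OF out coins])
    fix x y rA rB r
    assume xy: "x \<in> X" "y \<in> Y"
      and "(outA (transcript \<pi> x y rA rB r) r rA x, outB (transcript \<pi> x y rA rB r) r rB y)
          \<in> {(Some (f x y), None), (None, Some (f x y))}"
    \<comment> \<open>The position is counted from the end because the length of the original
      transcript may vary from run to run.\<close>
    then have "drop (length (transcript \<pi>' x y rA rB r) - k) (transcript \<pi>' x y rA rB r) = e (f x y)"
      by (auto simp: tr e(2) Let_def)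
    then show "inv_into Z e (drop (length (transcript \<pi>' x y rA rB r) - k)
        (transcript \<pi>' x y rA rB r)) = f x y"
      using e(1) fZ[OF xy] by simp
  qed
  moreover have "cost X Y \<pi>' \<le> enat (c + k + 1)"
    using c by (auto simp: cost_le_iff coins tr e(2) Let_def)
  ultimately show ?thesis
    unfolding R_open_def INF_enat_le_iff by auto
qed

text \<open>Rounding up and \<open>nat\<close> only increase the exponent. The value 0 is split off
  because the logarithm rule needs a positive argument.\<close>

lemma card_le_two_power_log:
  assumes "k = nat \<lceil>log 2 (real m)\<rceil>"
  shows "m \<le> 2 ^ k"
proof (cases "m = 0")
  case False
  have "log 2 (real m) \<le> real k"
    using assms by linarith
  then have "real m \<le> 2 powr real k"
    using False by (simp add: log_le_iff)
  then show ?thesis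
    by (simp add: powr_realpow)
qed simp

lemma R_open_le_R_oot:
  assumes "finite Z" and "card Z \<le> 2 ^ k"
    and "\<And>x y. x \<in> X \<Longrightarrow> y \<in> Y \<Longrightarrow> f x y \<in> Z"
  shows "R_open \<epsilon> X Y f \<le> R_oot \<epsilon> X Y f + enat k + 1"
proof (cases "R_oot \<epsilon> X Y f")
  case (enat c)
  then show ?thesis
    using R_open_le_if_R_oot_le[where X = X and Y = Y and f = f, OF assms, of \<epsilon> c] by (simp add: one_enat_def)
qed simp

section \<open>Upper bounds for \<open>CondId\<close>\<close>

text \<open>After the exchange both players know whether the first bits agree, hence whose input is
  the value. This includes \<open>n = 0\<close>, where \<open>[] ! 0\<close> is some fixed bit that
  protocol and function share.\<close>

lemma D_oot_CondId_le: "D_oot (bits n) (bits n) CondId \<le> enat 2"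
proof -
  define \<pi> :: "(bool list, bool list) protocol" where
    "\<pi> = \<lparr>Alice_coins = return_pmf 0, Bob_coins = return_pmf 0, public_coins = return_pmf 0,
      tree = \<lambda>r. let t = Bob_sends (\<lambda>(y, rB). y ! 0) Halt Halt in Alice_sends (\<lambda>(x, rA). x ! 0) t t\<rparr>"
  have tr: "transcript \<pi> x y rA rB r = [x ! 0, y ! 0]" for x y rA rB r
    by (simp add: \<pi>_def transcript_def Let_def)
  have "computes_oot 0 (bits n) (bits n) CondId \<pi>"
    unfolding computes_oot_def
    by (intro exI[of _ "\<lambda>t r rA x. if t ! 0 = t ! 1 then Some x else None"]
              exI[of _ "\<lambda>t r rB y. if t ! 0 = t ! 1 then None else Some y"] succeeds_always)
       (auto simp: tr CondId_def)
  moreover have "cost (bits n) (bits n) \<pi> \<le> enat 2"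
    by (auto simp: cost_le_iff tr)
  ultimately show ?thesis
    unfolding D_oot_def R_oot_def INF_enat_le_iff by auto
qed

lemma CondId_in_bits: "x \<in> bits n \<Longrightarrow> y \<in> bits n \<Longrightarrow> CondId x y \<in> bits n"
  by (simp add: CondId_def)

text \<open>Gives meaning to \<open>the_enat\<close> in the asymptotic statement. Finiteness comes
  from the chain of models itself: the constant one-out-of-two bound limits the open complexity,
  which limits the unilateral one.\<close>

lemma R_uni_CondId_finite:
  assumes "0 \<le> \<epsilon>"
  shows "R_uni \<epsilon> (bits n) (bits n) CondId \<noteq> \<infinity>"
proof -
  have "R_oot \<epsilon> (bits n) (bits n) CondId \<le> enat 2"
    using R_oot_antimono[OF assms] D_oot_CondId_le[of n] unfolding D_oot_def by (rule order_trans)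
  then have "R_open \<epsilon> (bits n) (bits n) CondId \<le> enat (2 + n + 1)"
    by (intro R_open_le_if_R_oot_le[OF finite_bits[of n]]) (auto simp: card_bits CondId_in_bits)
  then have "R_uni \<epsilon> (bits n) (bits n) CondId \<le> enat (2 + n + 1)"
    by (intro order_trans[OF R_uni_le_R_local] order_trans[OF R_local_le_R_open])
  then show ?thesis
    by (cases "R_uni \<epsilon> (bits n) (bits n) CondId") simp_all
qed

section \<open>Counting bound for unilateral protocols\<close>

text \<open>Double counting: the expected number of \<open>w\<close> with
  \<open>P w \<omega>\<close> is at least \<open>card W * q\<close> by linearity, and at most
  \<open>N\<close> because it is so on the support.\<close>

lemma card_mult_le_of_prob_ge:
  fixes M :: "'a pmf" and N :: nat
  assumes "finite W"
    and prob: "\<And>w. w \<in> W \<Longrightarrow> measure_pmf.prob M {\<omega>. P w \<omega>} \<ge> q"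
    and le: "\<And>\<omega>. \<omega> \<in> set_pmf M \<Longrightarrow> card {w \<in> W. P w \<omega>} \<le> N"
  shows "real (card W) * q \<le> real N"
proof -
  have int: "integrable (measure_pmf M) (indicator {\<omega>. P w \<omega>} :: 'a \<Rightarrow> real)" for w
    by (intro integrable_real_indicator) (auto simp: measure_pmf.emeasure_eq_measure)
  have "real (card W) * q \<le> (\<Sum>w\<in>W. measure_pmf.prob M {\<omega>. P w \<omega>})"
    using sum_mono[OF prob] by simp
  also have "\<dots> = measure_pmf.expectation M (\<lambda>\<omega>. \<Sum>w\<in>W. indicator {\<omega>. P w \<omega>} \<omega>)"
    using int by (simp add: Bochner_Integration.integral_sum)
  also have "\<dots> = measure_pmf.expectation M (\<lambda>\<omega>. real (card {w \<in> W. P w \<omega>}))"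
    using assms(1) by (simp add: indicator_def sum.If_cases Int_def)
  also have "\<dots> \<le> measure_pmf.expectation M (\<lambda>\<omega>. real N)"
  \<comment> \<open>The bound \<open>N\<close> is given on the support only, hence the
    almost-everywhere comparison; integrability rests on the bound \<open>card W\<close>, which
    holds for every outcome.\<close>
  proof (rule integral_mono_AE)
    have "card {w \<in> W. P w \<omega>} \<le> card W" for \<omega>
      using assms(1) by (intro card_mono) auto
    then show "integrable (measure_pmf M) (\<lambda>\<omega>. real (card {w \<in> W. P w \<omega>}))"
      by (intro measure_pmf.integrable_const_bound[of _ "real (card W)"]) auto
  qed (use le in \<open>auto simp: AE_measure_pmf_iff\<close>)
  finally show ?thesis by simp
qed

text \<open>Transcripts may have any length up to \<open>c\<close>, so the count is a geometric sum;
  this is where the exponent \<open>c + 1\<close> comes from.\<close>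

lemma card_bool_lists_length_le:
  "finite {p :: bool list. length p \<le> c}" "card {p :: bool list. length p \<le> c} \<le> 2 ^ (c + 1)"
proof -
  show "finite {p :: bool list. length p \<le> c}"
    using finite_lists_length_le[of "UNIV :: bool set" c] by simp
  have "(\<Sum>i\<le>m. 2 ^ i) \<le> (2 :: nat) ^ (m + 1)" for m
    by (induction m) auto
  then show "card {p :: bool list. length p \<le> c} \<le> 2 ^ (c + 1)"
    using card_lists_length_le[of "UNIV :: bool set" c] by simp
qed

text \<open>With the coins \<omega> fixed, the output depends on \<open>w\<close> only through the
  transcript. As \<open>g\<close> is injective, distinct correctly answered \<open>w\<close> need
  distinct transcripts. \<open>T\<close> is abstract so that \<open>w\<close> can be the hidden
  input of either player.\<close>

lemma card_mult_le_of_short_transcripts: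
  fixes T :: "'w \<Rightarrow> 'a \<Rightarrow> bool list"
  assumes "finite W" and inj: "inj_on g W"
    and prob: "\<And>w. w \<in> W \<Longrightarrow> measure_pmf.prob M {\<omega>. out (T w \<omega>) \<omega> = g w} \<ge> q"
    and len: "\<And>w \<omega>. w \<in> W \<Longrightarrow> \<omega> \<in> set_pmf M \<Longrightarrow> length (T w \<omega>) \<le> c"
  shows "real (card W) * q \<le> 2 ^ (c + 1)"
proof -
  have "card {w \<in> W. out (T w \<omega>) \<omega> = g w} \<le> 2 ^ (c + 1)" if "\<omega> \<in> set_pmf M" for \<omega>
  proof -
    have "inj_on (\<lambda>w. T w \<omega>) {w \<in> W. out (T w \<omega>) \<omega> = g w}"
      using inj by (auto simp: inj_on_def)
    then have "card {w \<in> W. out (T w \<omega>) \<omega> = g w} \<le> card {p :: bool list. length p \<le> c}"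
      using len that by (intro card_inj_on_le card_bool_lists_length_le(1)) auto
    then show ?thesis
      using card_bool_lists_length_le(2) order_trans by blast
  qed
  with assms(1) prob have "real (card W) * q \<le> real (2 ^ (c + 1))"
    by (rule card_mult_le_of_prob_ge[where P = "\<lambda>w \<omega>. out (T w \<omega>) \<omega> = g w"])
  then show ?thesis by simp
qed

lemma R_Alice_lower_bound:
  assumes "R_Alice \<epsilon> X Y f \<le> enat c"
    and "x \<in> X" and "W \<subseteq> Y" and "finite W" and "inj_on (f x) W"
  shows "real (card W) * (1 - \<epsilon>) \<le> 2 ^ (c + 1)"
proof -
  obtain \<pi> outA where c: "cost X Y \<pi> \<le> enat c"
    and out: "succeeds \<epsilon> X Y \<pi> (\<lambda>x y rA rB r. outA (transcript \<pi> x y rA rB r) r rA x = f x y)"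
    using assms(1) unfolding R_Alice_def INF_enat_le_iff computes_Alice_def by blast
  \<comment> \<open>The input \<open>x\<close> is fixed and becomes part of \<open>T\<close> and
    \<open>out'\<close>; Bob's input is the varying \<open>w\<close>, and \<omega> comprises all
    three random strings.\<close>
  define T where "T = (\<lambda>y (rA, rB, r). transcript \<pi> x y rA rB r)"
  define out' where "out' = (\<lambda>t (rA, rB :: nat, r). outA t r rA x)"
  show ?thesis
  proof (rule card_mult_le_of_short_transcripts[where T = T and out = out', OF assms(4,5)])
    fix y assume "y \<in> W"
    then show "1 - \<epsilon> \<le> measure_pmf.prob (coins \<pi>) {\<omega>. out' (T y \<omega>) \<omega> = f x y}"
      using out assms(2,3) by (auto simp: succeeds_def T_def out'_def case_prod_unfold)
  next
    fix y \<omega> assume "y \<in> W" "\<omega> \<in> set_pmf (coins \<pi>)"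
    then show "length (T y \<omega>) \<le> c"
      using c assms(2,3) by (cases \<omega>) (auto simp: cost_le_iff T_def)
  qed
qed

lemma R_Bob_lower_bound:
  assumes "R_Bob \<epsilon> X Y f \<le> enat c"
    and "y \<in> Y" and "W \<subseteq> X" and "finite W" and "inj_on (\<lambda>x. f x y) W"
  shows "real (card W) * (1 - \<epsilon>) \<le> 2 ^ (c + 1)"
proof -
  obtain \<pi> outB where c: "cost X Y \<pi> \<le> enat c"
    and out: "succeeds \<epsilon> X Y \<pi> (\<lambda>x y rA rB r. outB (transcript \<pi> x y rA rB r) r rB y = f x y)"
    using assms(1) unfolding R_Bob_def INF_enat_le_iff computes_Bob_def by blast
  define T where "T = (\<lambda>x (rA, rB, r). transcript \<pi> x y rA rB r)"
  define out' where "out' = (\<lambda>t (rA :: nat, rB, r). outB t r rB y)"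
  show ?thesis
  proof (rule card_mult_le_of_short_transcripts[where T = T and out = out', OF assms(4,5)])
    fix x assume "x \<in> W"
    then show "1 - \<epsilon> \<le> measure_pmf.prob (coins \<pi>) {\<omega>. out' (T x \<omega>) \<omega> = f x y}"
      using out assms(2,3) by (auto simp: succeeds_def T_def out'_def case_prod_unfold)
  next
    fix x \<omega> assume "x \<in> W" "\<omega> \<in> set_pmf (coins \<pi>)"
    then show "length (T x \<omega>) \<le> c"
      using c assms(2,3) by (cases \<omega>) (auto simp: cost_le_iff T_def)
  qed
qed

section \<open>Linear lower bound for \<open>CondId\<close>\<close>

text \<open>Length \<open>Suc m\<close> leaves \<open>m\<close> free bits after the first one, so
  each half cube \<open>W b\<close> offers \<open>2 ^ m\<close> values to be told apart.\<close>

lemma le_of_R_uni_CondId_le: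
  assumes "R_uni \<epsilon> (bits (Suc m)) (bits (Suc m)) CondId \<le> enat c" and "\<epsilon> < 1/2"
  shows "m \<le> c + 1"
proof -
  define W where "W b = (#) b ` bits m" for b
  have W: "W b \<subseteq> bits (Suc m)" "finite (W b)" "card (W b) = 2 ^ m" for b
    by (auto simp: W_def bits_def card_image finite_bits[unfolded bits_def]
        card_bits[unfolded bits_def])
  have z: "replicate (Suc m) False \<in> bits (Suc m)"
    by (simp add: bits_def)
  \<comment> \<open>Against the all-\<open>False\<close> string, first bit \<open>True\<close> makes
    \<open>CondId\<close> return Bob's input, and first bit \<open>False\<close> makes it return
    Alice's; both maps are the identity on \<open>W b\<close>.\<close>
  have "inj_on (CondId (replicate (Suc m) False)) (W True)"
    and "inj_on (\<lambda>x. CondId x (replicate (Suc m) False)) (W False)"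
    by (auto simp: inj_on_def W_def CondId_def)
  then have "real (2 ^ m) * (1 - \<epsilon>) \<le> 2 ^ (c + 1)"
    using assms(1) R_Alice_lower_bound[OF _ z W(1,2)] R_Bob_lower_bound[OF _ z W(1,2)]
    unfolding R_uni_def min_le_iff_disj W(3) by blast
  \<comment> \<open>Since 1 - \<epsilon> exceeds 1/2, the error costs one further factor of 2,
    raising the exponent from \<open>c + 1\<close> to \<open>c + 2\<close>.\<close>
  moreover have "real (2 ^ m) * (1/2) < real (2 ^ m) * (1 - \<epsilon>)"
    using assms(2) by (intro mult_strict_left_mono) auto
  ultimately have "(2 :: real) ^ m < 2 ^ (c + 2)"
    by (simp only: of_nat_power of_nat_numeral power_add power2_eq_square power_one_right)
  then have "m < c + 2"
    by (simp only: power_strict_increasing_iff)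
  then show ?thesis by simp
qed

lemma R_uni_CondId_bigomega:
  assumes "0 \<le> \<epsilon>" and "\<epsilon> < 1/2"
  shows "(\<lambda>n. real (the_enat (R_uni \<epsilon> (bits n) (bits n) CondId))) \<in> \<Omega>(\<lambda>n. real n)"
proof (rule landau_omega.bigI[of "1/2"])
  show "\<forall>\<^sub>F n in sequentially.
      norm (real (the_enat (R_uni \<epsilon> (bits n) (bits n) CondId))) \<ge> 1/2 * norm (real n)"
    \<comment> \<open>The previous bound reads n - 2 \<le> c, and n - 2 is at least n/2 exactly from
      n = 4 on.\<close>
    using eventually_ge_at_top[of 4]
  proof eventually_elim
    case (elim n)
    then obtain m where m: "n = Suc m" by (cases n) auto
    obtain c where c: "R_uni \<epsilon> (bits n) (bits n) CondId = enat c"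
      using R_uni_CondId_finite[OF assms(1)] by blast
    then have "m \<le> c + 1"
      using le_of_R_uni_CondId_le[of \<epsilon> m c] assms(2) m by simp
    then show ?case
      using c m elim by simp
  qed
qed simp

theorem mainTheorem11:
  fixes X :: "'x set" and Y :: "'y set" and Z :: "'z set"
    and f :: "'x \<Rightarrow> 'y \<Rightarrow> 'z" and k :: nat and \<epsilon> :: real
  assumes "finite Z"
    and "\<And>x y. x \<in> X \<Longrightarrow> y \<in> Y \<Longrightarrow> f x y \<in> Z"
    and "k = nat \<lceil>log 2 (real (card Z))\<rceil>"
    and "0 < \<epsilon>" and "\<epsilon> < 1/2"
  shows "R_oot \<epsilon> X Y f \<le> R_uni \<epsilon> X Y f
       \<and> R_uni \<epsilon> X Y f \<le> R_local \<epsilon> X Y f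
       \<and> R_local \<epsilon> X Y f \<le> R_open \<epsilon> X Y f
       \<and> R_open \<epsilon> X Y f \<le> R_oot \<epsilon> X Y f + enat k + 1
       \<and> (\<forall>n. D_oot (bits n) (bits n) CondId \<noteq> \<infinity>)
       \<and> (\<lambda>n. real (the_enat (D_oot (bits n) (bits n) CondId))) \<in> O(\<lambda>n. 1)
       \<and> (\<forall>n. R_uni \<epsilon> (bits n) (bits n) CondId \<noteq> \<infinity>)
       \<and> (\<lambda>n. real (the_enat (R_uni \<epsilon> (bits n) (bits n) CondId))) \<in> \<Omega>(\<lambda>n. real n)"
proof (intro conjI allI)
  show "R_open \<epsilon> X Y f \<le> R_oot \<epsilon> X Y f + enat k + 1"
    using assms(1,2) card_le_two_power_log[OF assms(3)] by (intro R_open_le_R_oot)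
  show "D_oot (bits n) (bits n) CondId \<noteq> \<infinity>" for n
    using D_oot_CondId_le[of n] by (cases "D_oot (bits n) (bits n) CondId") simp_all
  have "the_enat (D_oot (bits n) (bits n) CondId) \<le> 2" for n
    using D_oot_CondId_le[of n] by (cases "D_oot (bits n) (bits n) CondId") simp_all
  then show "(\<lambda>n. real (the_enat (D_oot (bits n) (bits n) CondId))) \<in> O(\<lambda>n. 1)"
    by (intro landau_o.bigI[of 2]) auto
qed (use assms(4,5) in \<open>auto simp: R_oot_le_R_uni R_uni_le_R_local R_local_le_R_open
    R_uni_CondId_finite intro: R_uni_CondId_bigomega\<close>)

end
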